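(* Let $n\ge1$, $k\ge0$ an integer, $\alpha,\beta\in\mathbb R$. For every $f\in C_c^{k+1}(\mathbb R^n\setminus\{0\})$, $R_{\alpha,k}(r^\beta f)=r^\beta R_{\alpha-2\beta,k}(f)$. For every $f\in C_c^{k+2}(\mathbb R^n\setminus\{0\})$, $$\|R_{\alpha,k}(\partial_rf)\|_\alpha^2=\frac{(n-2k-4-\alpha)^2}{4}\|R_{\alpha+2,k}(f)\|_{\alpha+2}^2+\|R_{\alpha,k+1}(f)\|_\alpha^2$$ and $$\langle R_{\alpha,k}(\partial_rf),R_{\alpha+2,k}(f)\rangle_{\alpha+1}=\frac{\alpha+2k+4-n}{2}\|R_{\alpha+2,k}(f)\|_{\alpha+2}^2 .$$
   Context: Write $r=|x|$ for $x\in\mathbb R^n$. For $\beta\in\mathbb R$ and $f,g$ continuous with compact support in $\mathbb R^n\setminus\{0\}$, set $\|g\|_\beta^2=\int_{\mathbb R^n}|g(x)|^2|x|^{-\beta}\,dx$ and $\langle f,g\rangle_\beta=\int_{\mathbb R^n}f(x)g(x)|x|^{-\beta}\,dx$. Let $\partial_r=\sum_{i=1}^n\frac{x_i}{r}\partial_{x_i}$; for $\alpha\in\mathbb R$, $T_\alpha f=\partial_r f+\frac{n-2-\alpha}{2r}f$; for an integer $k\ge0$, $R_{\alpha,k}=T_\alpha\circ T_{\alpha+2}\circ\cdots\circ T_{\alpha+2k}$ (composition of $k+1$ operators, so $R_{\alpha,0}=T_\alpha$). *)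

theory Defs
  imports "HOL-Analysis.Analysis"
begin

text \<open>Functions of class C^m on the whole space: C^0 = continuous, and C^(m+1) =
  differentiable everywhere with all first partial derivatives of class C^m.\<close>
fun Cm :: "nat \<Rightarrow> ('a::euclidean_space \<Rightarrow> real) \<Rightarrow> bool" where
  "Cm 0 f = continuous_on UNIV f"
| "Cm (Suc m) f = ((\<forall>x. f differentiable (at x)) \<and>
      (\<forall>i\<in>Basis. Cm m (\<lambda>x. frechet_derivative f (at x) i)))"

text \<open>f belongs to C_c^m(R^n minus 0) (extended by zero): C^m with compact support
  not containing the origin.\<close>
definition Cc_punct :: "nat \<Rightarrow> ('a::euclidean_space \<Rightarrow> real) \<Rightarrow> bool" where
  "Cc_punct m f \<longleftrightarrow> Cm m f \<and> compact (closure {x. f x \<noteq> 0})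
      \<and> 0 \<notin> closure {x. f x \<noteq> 0}"

text \<open>Radial derivative: directional derivative in direction x/|x|.\<close>
definition rad_deriv :: "('a::euclidean_space \<Rightarrow> real) \<Rightarrow> 'a \<Rightarrow> real" where
  "rad_deriv f x = frechet_derivative f (at x) (x /\<^sub>R norm x)"

definition T_op :: "real \<Rightarrow> ('a::euclidean_space \<Rightarrow> real) \<Rightarrow> 'a \<Rightarrow> real" where
  "T_op \<alpha> f x = rad_deriv f x + (real DIM('a) - 2 - \<alpha>) / (2 * norm x) * f x"

text \<open>R_{alpha,k} = T_alpha o T_{alpha+2} o ... o T_{alpha+2k}.\<close>
fun R_op :: "real \<Rightarrow> nat \<Rightarrow> ('a::euclidean_space \<Rightarrow> real) \<Rightarrow> 'a \<Rightarrow> real" where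
  "R_op \<alpha> 0 f = T_op \<alpha> f"
| "R_op \<alpha> (Suc k) f = T_op \<alpha> (R_op (\<alpha> + 2) k f)"

definition wnorm2 :: "real \<Rightarrow> ('a::euclidean_space \<Rightarrow> real) \<Rightarrow> real" where
  "wnorm2 \<beta> g = (LINT x|lborel. (g x)\<^sup>2 * norm x powr (- \<beta>))"

definition winner :: "real \<Rightarrow> ('a::euclidean_space \<Rightarrow> real) \<Rightarrow> ('a \<Rightarrow> real) \<Rightarrow> real" where
  "winner \<beta> f g = (LINT x|lborel. f x * g x * norm x powr (- \<beta>))"

end

theory Submission
  imports Defs
begin

text \<open>
  The first identity is the product rule: the radial derivative of \<open>r\<^sup>\<beta>\<close> is \<open>\<beta> r\<^sup>\<beta>\<^sup>-\<^sup>1\<close>, which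
  is absorbed by shifting the index of every \<open>T\<close> in the chain by \<open>-2\<beta>\<close>.

  For the second, put \<open>g = R\<^sub>\<alpha>\<^sub>+\<^sub>2\<^sub>,\<^sub>k f\<close>. Writing \<open>\<partial>\<^sub>r = T\<^sub>\<alpha>\<^sub>+\<^sub>2\<^sub>k\<^sub>+\<^sub>2 - c/r\<close> with
  \<open>c = (n - \<alpha> - 2k - 4)/2\<close> and commuting \<open>1/r\<close> through \<open>R\<^sub>\<alpha>\<^sub>,\<^sub>k\<close> by the first identity gives
  \<open>R\<^sub>\<alpha>\<^sub>,\<^sub>k(\<partial>\<^sub>r f) = T\<^sub>\<alpha> g - c g/r\<close>. Both formulas then follow by expanding the square, once
  one knows that \<open>T\<^sub>\<alpha> g\<close> is orthogonal to \<open>g\<close> for the weight \<open>|x|\<^sup>-\<^sup>\<alpha>\<^sup>-\<^sup>1\<close>. That orthogonality is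
  the integration by parts \<open>\<integral> \<phi>'(x) x dx = -n \<integral> \<phi>\<close> for \<open>\<phi> = g\<^sup>2 |x|\<^sup>-\<^sup>\<alpha>\<^sup>-\<^sup>2\<close>.
\<close>

section \<open>Smoothness away from the origin\<close>

text \<open>The weights \<open>|x|\<^sup>\<beta>\<close> are smooth only on \<open>\<real>\<^sup>n - {0}\<close>, so the induction over \<open>R\<close> is carried
  out in this class rather than in \<open>Cm\<close>.\<close>

fun Cm_punct :: "nat \<Rightarrow> ('a::euclidean_space \<Rightarrow> real) \<Rightarrow> bool" where
  "Cm_punct 0 f = continuous_on (-{0}) f"
| "Cm_punct (Suc m) f = ((\<forall>x. x \<noteq> 0 \<longrightarrow> f differentiable (at x)) \<and>
      (\<forall>i\<in>Basis. Cm_punct m (\<lambda>x. frechet_derivative f (at x) i)))"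

lemma open_Compl_singleton_0: "open (-{0::'a::euclidean_space})"
  by auto

lemma frechet_derivative_cong_open:
  assumes "open V" "x \<in> V" "\<And>y. y \<in> V \<Longrightarrow> u y = v y"
  shows "frechet_derivative u (at x) = frechet_derivative v (at x)"
proof -
  have "(\<lambda>D. (u has_derivative D) (at x)) = (\<lambda>D. (v has_derivative D) (at x))"
    using has_derivative_transform_within_open[OF _ assms(1,2), of u _ UNIV v]
      has_derivative_transform_within_open[OF _ assms(1,2), of v _ UNIV u] assms(3)
    by (auto intro!: ext)
  then show ?thesis
    unfolding frechet_derivative_def by simp
qed

lemma frechet_derivative_add:
  assumes "f differentiable (at x)" "g differentiable (at x)"
  shows "frechet_derivative (\<lambda>y. f y + g y) (at x) =
    (\<lambda>v. frechet_derivative f (at x) v + frechet_derivative g (at x) v)"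
  by (rule frechet_derivative_at[symmetric], rule has_derivative_add)
    (use assms in \<open>simp_all add: frechet_derivative_works[symmetric]\<close>)

lemma frechet_derivative_mult:
  fixes f g :: "'a::real_normed_vector \<Rightarrow> real"
  assumes "f differentiable (at x)" "g differentiable (at x)"
  shows "frechet_derivative (\<lambda>y. f y * g y) (at x) =
    (\<lambda>v. f x * frechet_derivative g (at x) v + frechet_derivative f (at x) v * g x)"
  by (rule frechet_derivative_at[symmetric], rule has_derivative_mult)
    (use assms in \<open>simp_all add: frechet_derivative_works[symmetric]\<close>)

lemma frechet_derivative_diff_scaled:
  fixes u v :: "'a::real_normed_vector \<Rightarrow> real"
  assumes "u differentiable (at x)" "v differentiable (at x)"
  shows "frechet_derivative (\<lambda>y. u y - e * v y) (at x) =
    (\<lambda>w. frechet_derivative u (at x) w - e * frechet_derivative v (at x) w)"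
  by (rule frechet_derivative_at[symmetric], intro has_derivative_diff has_derivative_mult_right)
    (use assms in \<open>simp_all add: frechet_derivative_works[symmetric]\<close>)

lemma frechet_derivative_euclidean_expansion:
  assumes "f differentiable (at x)"
  shows "frechet_derivative f (at x) v = (\<Sum>i\<in>Basis. (v \<bullet> i) * frechet_derivative f (at x) i)"
proof -
  have "linear (frechet_derivative f (at x))"
    using linear_frechet_derivative[OF assms] .
  then show ?thesis
    by (subst euclidean_representation[symmetric, of v]) (simp add: linear_sum linear_scale)
qed

lemma has_derivative_norm_powr:
  assumes "(x::'a::euclidean_space) \<noteq> 0"
  shows "((\<lambda>y. norm y powr p) has_derivative (\<lambda>v. p * norm x powr (p - 2) * (x \<bullet> v))) (at x)"
proof -
  have nx: "norm x > 0"
    using assms by simp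
  have "((\<lambda>y. norm y powr p) has_derivative
      (\<lambda>v. norm x powr p * (0 * ln (norm x) + (v \<bullet> sgn x) * p / norm x))) (at x)"
    by (rule has_derivative_powr[OF has_derivative_norm[OF assms] has_derivative_const])
      (use assms in auto)
  moreover have "norm x powr p * (0 * ln (norm x) + (v \<bullet> sgn x) * p / norm x) =
      p * norm x powr (p - 2) * (x \<bullet> v)" for v
  proof -
    have sgn: "v \<bullet> sgn x = (x \<bullet> v) / norm x"
      by (simp add: sgn_div_norm inner_commute field_simps)
    have powr: "norm x powr (p - 2) = norm x powr p / (norm x * norm x)"
      using nx by (simp add: powr_diff power2_eq_square)
    show ?thesis
      unfolding sgn powr using nx by (simp add: field_simps)
  qed
  ultimately show ?thesis
    by simp
qed

lemma Cm_punct_Suc_imp: "Cm_punct (Suc m) f \<Longrightarrow> Cm_punct m f"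
proof (induction m arbitrary: f)
  case 0
  then show ?case
    by (auto intro!: continuous_at_imp_continuous_on differentiable_imp_continuous_within)
qed auto

lemma Cm_punct_le: "Cm_punct m f \<Longrightarrow> k \<le> m \<Longrightarrow> Cm_punct k f"
  by (induction m) (auto simp: le_Suc_eq simp del: Cm_punct.simps(2) dest: Cm_punct_Suc_imp)

lemma Cm_punct_cong: "Cm_punct m f \<Longrightarrow> (\<And>x. x \<noteq> 0 \<Longrightarrow> f x = g x) \<Longrightarrow> Cm_punct m g"
proof (induction m arbitrary: f g)
  case 0
  then show ?case
    using continuous_on_cong[of "-{0}" "-{0}" f g] by auto
next
  case (Suc m)
  have "g differentiable (at x)" if "x \<noteq> 0" for x
  proof -
    have "f differentiable (at x)"
      using Suc.prems(1) that by simp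
    then obtain D where "(f has_derivative D) (at x)"
      unfolding differentiable_def by blast
    then have "(g has_derivative D) (at x)"
      by (rule has_derivative_transform_within_open[OF _ open_Compl_singleton_0])
        (use that Suc.prems(2) in auto)
    then show ?thesis
      unfolding differentiable_def by blast
  qed
  moreover have "frechet_derivative f (at x) = frechet_derivative g (at x)" if "x \<noteq> 0" for x
    using frechet_derivative_cong_open[OF open_Compl_singleton_0, of x f g] Suc.prems that by auto
  ultimately show ?case
    using Suc.prems Suc.IH[of "\<lambda>x. frechet_derivative f (at x) i"
        "\<lambda>x. frechet_derivative g (at x) i" for i]
    by auto
qed

lemma Cm_imp_Cm_punct: "Cm m f \<Longrightarrow> Cm_punct m f"
  by (induction m arbitrary: f) (auto intro: continuous_on_subset)

lemma Cm_punct_const: "Cm_punct m (\<lambda>x. c)"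
  by (induction m arbitrary: c) auto

lemma Cm_punct_add: "Cm_punct m f \<Longrightarrow> Cm_punct m g \<Longrightarrow> Cm_punct m (\<lambda>x. f x + g x)"
proof (induction m arbitrary: f g)
  case 0
  then show ?case
    by (auto intro!: continuous_intros)
next
  case (Suc m)
  have "Cm_punct m (\<lambda>x. frechet_derivative (\<lambda>x. f x + g x) (at x) i)" if "i \<in> Basis" for i
    by (rule Cm_punct_cong[OF Suc.IH])
      (use Suc.prems that in \<open>simp_all add: frechet_derivative_add\<close>)
  then show ?case
    using Suc.prems by auto
qed

lemma Cm_punct_mult: "Cm_punct m f \<Longrightarrow> Cm_punct m g \<Longrightarrow> Cm_punct m (\<lambda>x. f x * g x)"
proof (induction m arbitrary: f g)
  case 0
  then show ?case
    by (auto intro!: continuous_intros)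
next
  case (Suc m)
  have "Cm_punct m (\<lambda>x. frechet_derivative (\<lambda>x. f x * g x) (at x) i)" if "i \<in> Basis" for i
    by (rule Cm_punct_cong[OF Cm_punct_add[OF Suc.IH Suc.IH]])
      (use Suc.prems that Cm_punct_Suc_imp in \<open>simp_all add: frechet_derivative_mult\<close>)
  then show ?case
    using Suc.prems by auto
qed

lemma Cm_punct_sum:
  "finite A \<Longrightarrow> (\<And>i. i \<in> A \<Longrightarrow> Cm_punct m (F i)) \<Longrightarrow> Cm_punct m (\<lambda>x. \<Sum>i\<in>A. F i x)"
  by (induction A rule: finite_induct) (auto intro: Cm_punct_add Cm_punct_const)

lemma Cm_punct_inner_left: "Cm_punct m (\<lambda>x::'a::euclidean_space. x \<bullet> j)"
proof (induction m)
  case (Suc m)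
  have "frechet_derivative (\<lambda>x::'a. x \<bullet> j) (at x) = (\<lambda>v. v \<bullet> j)" for x
    by (rule frechet_derivative_at[symmetric]) (auto intro!: derivative_eq_intros)
  then show ?case
    by (simp add: Cm_punct_const)
qed (auto intro!: continuous_intros)

lemma Cm_punct_norm_powr: "Cm_punct m (\<lambda>x::'a::euclidean_space. norm x powr p)"
proof (induction m arbitrary: p)
  case (Suc m)
  have "frechet_derivative (\<lambda>x::'a. norm x powr p) (at x) =
      (\<lambda>v. p * norm x powr (p - 2) * (x \<bullet> v))" if "x \<noteq> 0" for x
    by (rule frechet_derivative_at[symmetric, OF has_derivative_norm_powr[OF that]])
  then have "Cm_punct m (\<lambda>x::'a. frechet_derivative (\<lambda>x. norm x powr p) (at x) i)" for i
    by (intro Cm_punct_cong[OF Cm_punct_mult[OF Cm_punct_mult[OF Cm_punct_const Suc.IH]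
          Cm_punct_inner_left]]) simp
  moreover have "(\<lambda>x::'a. norm x powr p) differentiable at x" if "x \<noteq> 0" for x
    using has_derivative_norm_powr[OF that] unfolding differentiable_def by blast
  ultimately show ?case
    by simp
qed (auto intro!: continuous_intros)

lemma continuous_on_norm_powr_punct: "continuous_on (-{0}) (\<lambda>x::'a::euclidean_space. norm x powr p)"
  using Cm_punct_norm_powr[of 0 p] by simp

section \<open>The operators \<open>T\<close> and \<open>R\<close>\<close>

lemma Cm_punct_rad_deriv:
  assumes f: "Cm_punct (Suc m) f"
  shows "Cm_punct m (rad_deriv f)"
proof (rule Cm_punct_cong)
  show "Cm_punct m
      (\<lambda>x. \<Sum>i\<in>Basis. ((x \<bullet> i) * norm x powr (-1)) * frechet_derivative f (at x) i)"
    using f by (intro Cm_punct_sum Cm_punct_mult Cm_punct_inner_left Cm_punct_norm_powr) auto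
  show "(\<Sum>i\<in>Basis. ((x \<bullet> i) * norm x powr (-1)) * frechet_derivative f (at x) i) = rad_deriv f x"
    if "x \<noteq> 0" for x
    unfolding rad_deriv_def using f that
    by (subst (2) frechet_derivative_euclidean_expansion) (simp_all add: divide_inverse mult.commute)
qed

lemma frechet_derivative_apply_self:
  assumes "g differentiable (at x)"
  shows "frechet_derivative g (at x) x = norm x * rad_deriv g x"
proof -
  have lin: "linear (frechet_derivative g (at x))"
    by (rule linear_frechet_derivative[OF assms])
  show ?thesis
  proof (cases "x = 0")
    case True
    then show ?thesis
      using linear_0[OF lin] by simp
  next
    case False
    then show ?thesis
      unfolding rad_deriv_def using linear_scale[OF lin, of "norm x" "x /\<^sub>R norm x"] by simp
  qed
qed

text \<open>At the origin both sides reduce to \<open>rad_deriv f 0\<close>, since \<open>c / 0 = 0\<close> and \<open>0 powr -1 = 0\<close>.\<close>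

lemma T_op_eq_rad_deriv_plus:
  "T_op c f = (\<lambda>x. rad_deriv f x + (real DIM('a) - 2 - c) / 2 * (norm x powr (-1) * f x))"
  for f :: "'a::euclidean_space \<Rightarrow> real"
  by (auto simp: T_op_def)

lemma Cm_punct_T_op:
  assumes "Cm_punct (Suc m) f"
  shows "Cm_punct m (T_op c f)"
  unfolding T_op_eq_rad_deriv_plus
  by (intro Cm_punct_add Cm_punct_mult Cm_punct_rad_deriv Cm_punct_norm_powr Cm_punct_const
      assms Cm_punct_Suc_imp[OF assms])

lemma Cm_punct_R_op: "Cm_punct (k + 1 + m) f \<Longrightarrow> Cm_punct m (R_op c k f)"
proof (induction k arbitrary: c m)
  case 0
  then show ?case
    by (simp add: Cm_punct_T_op)
next
  case (Suc k)
  then have "Cm_punct (Suc m) (R_op (c + 2) k f)"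
    using Suc.IH[of "Suc m"] by simp
  then show ?case
    by (simp add: Cm_punct_T_op)
qed

lemma differentiable_R_op:
  "Cm_punct (k + 2) f \<Longrightarrow> x \<noteq> 0 \<Longrightarrow> R_op c k f differentiable (at x)"
  using Cm_punct_R_op[of k 1 f c] by simp

lemma R_op_eq_0_open:
  assumes "open V" "\<And>y. y \<in> V \<Longrightarrow> f y = 0" "x \<in> V"
  shows "R_op c k f x = 0"
proof -
  have T_op_0: "T_op c g x = 0" if "\<And>y. y \<in> V \<Longrightarrow> g y = 0" "x \<in> V" for c g x
    using frechet_derivative_cong_open[OF assms(1), of x g "\<lambda>_. 0"] that
    unfolding T_op_def rad_deriv_def by simp
  show ?thesis
    using assms(2,3) by (induction k arbitrary: c x) (simp_all add: T_op_0)
qed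

lemma T_op_cong_punct: "x \<noteq> 0 \<Longrightarrow> (\<And>y. y \<noteq> 0 \<Longrightarrow> u y = v y) \<Longrightarrow> T_op c u x = T_op c v x"
  unfolding T_op_def rad_deriv_def
  using frechet_derivative_cong_open[OF open_Compl_singleton_0, of x u v] by simp

lemma R_op_Suc_right: "R_op a (Suc k) f = R_op a k (T_op (a + 2 * real k + 2) f)"
proof (induction k arbitrary: a)
  case (Suc k)
  have "a + 2 + 2 * real k + 2 = a + 2 * real (Suc k) + 2"
    by simp
  then show ?case
    using Suc.IH[of "a + 2"] by (simp only: R_op.simps)
qed simp

lemma T_op_diff_scaled:
  fixes u v :: "'a::euclidean_space \<Rightarrow> real"
  assumes "u differentiable (at x)" "v differentiable (at x)" "x \<noteq> 0"
  shows "T_op a (\<lambda>y. u y - e * v y) x = T_op a u x - e * T_op a v x"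
  using assms unfolding T_op_def rad_deriv_def frechet_derivative_diff_scaled[OF assms(1,2)]
  by (simp add: field_simps)

lemma R_op_diff_scaled:
  fixes u v :: "'a::euclidean_space \<Rightarrow> real"
  assumes "Cm_punct (k + 1) u" "Cm_punct (k + 1) v" "x \<noteq> 0"
  shows "R_op a k (\<lambda>y. u y - e * v y) x = R_op a k u x - e * R_op a k v x"
  using assms
proof (induction k arbitrary: a x)
  case 0
  then show ?case
    using T_op_diff_scaled[of u x v a] by simp
next
  case (Suc k)
  have "R_op a (Suc k) (\<lambda>y. u y - e * v y) x =
      T_op a (\<lambda>y. R_op (a + 2) k u y - e * R_op (a + 2) k v y) x"
    unfolding R_op.simps
    by (rule T_op_cong_punct[OF Suc.prems(3)])
      (use Suc.IH[OF Cm_punct_le[OF Suc.prems(1)] Cm_punct_le[OF Suc.prems(2)]] in simp)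
  also have "\<dots> = R_op a (Suc k) u x - e * R_op a (Suc k) v x"
    using Suc.prems by (simp add: T_op_diff_scaled differentiable_R_op)
  finally show ?case .
qed

lemma T_op_norm_powr_mult:
  fixes h :: "'a::euclidean_space \<Rightarrow> real"
  assumes "x \<noteq> 0" "h differentiable (at x)"
  shows "T_op a (\<lambda>y. norm y powr b * h y) x = norm x powr b * T_op (a - 2 * b) h x"
proof -
  have "frechet_derivative (\<lambda>y. norm y powr b * h y) (at x) =
      (\<lambda>v. norm x powr b * frechet_derivative h (at x) v + b * norm x powr (b - 2) * (x \<bullet> v) * h x)"
    by (rule frechet_derivative_at[symmetric])
      (use has_derivative_mult[OF has_derivative_norm_powr[OF assms(1)]
          assms(2)[unfolded frechet_derivative_works]] in simp)
  moreover have nx: "norm x > 0"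
    using assms by simp
  moreover have "x \<bullet> (x /\<^sub>R norm x) = norm x"
    using nx by (simp add: dot_square_norm power2_eq_square)
  moreover have "norm x powr (b - 2) * norm x = norm x powr b / norm x"
    using nx by (simp add: powr_diff power2_eq_square)
  ultimately show ?thesis
    unfolding T_op_def rad_deriv_def by (simp add: field_simps)
qed

lemma R_op_norm_powr_mult:
  fixes f :: "'a::euclidean_space \<Rightarrow> real"
  assumes "Cm_punct (k + 1) f" "x \<noteq> 0"
  shows "R_op a k (\<lambda>y. norm y powr b * f y) x = norm x powr b * R_op (a - 2 * b) k f x"
  using assms
proof (induction k arbitrary: a x)
  case 0
  then show ?case
    using T_op_norm_powr_mult[of x f a b] by simp
next
  case (Suc k)
  have "R_op a (Suc k) (\<lambda>y. norm y powr b * f y) x =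
      T_op a (\<lambda>y. norm y powr b * R_op (a - 2 * b + 2) k f y) x"
    unfolding R_op.simps
    by (intro T_op_cong_punct[OF Suc.prems(2)])
      (simp add: Suc.IH[OF Cm_punct_le[OF Suc.prems(1)]] diff_add_eq)
  also have "\<dots> = norm x powr b * R_op (a - 2 * b) (Suc k) f x"
    using Suc.prems by (simp add: T_op_norm_powr_mult differentiable_R_op)
  finally show ?case .
qed

lemma R_op_rad_deriv:
  fixes f :: "'a::euclidean_space \<Rightarrow> real" and \<alpha> :: real and k :: nat
  assumes f: "Cm_punct (k + 2) f" and x: "x \<noteq> 0"
  defines "c \<equiv> (real DIM('a) - \<alpha> - 2 * real k - 4) / 2"
  shows "R_op \<alpha> k (rad_deriv f) x =
    R_op \<alpha> (Suc k) f x - c * (norm x powr (-1) * R_op (\<alpha> + 2) k f x)"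
proof -
  have "(real DIM('a) - 2 - (\<alpha> + 2 * real k + 2)) / 2 = c"
    by (simp add: c_def)
  then have "rad_deriv f = (\<lambda>y. T_op (\<alpha> + 2 * real k + 2) f y - c * (norm y powr (-1) * f y))"
    unfolding T_op_eq_rad_deriv_plus by simp
  then have "R_op \<alpha> k (rad_deriv f) x =
      R_op \<alpha> k (T_op (\<alpha> + 2 * real k + 2) f) x - c * R_op \<alpha> k (\<lambda>y. norm y powr (-1) * f y) x"
    using f by (simp only:) (intro R_op_diff_scaled Cm_punct_T_op Cm_punct_mult Cm_punct_norm_powr
        Cm_punct_le[OF f] x, simp_all)
  also have "R_op \<alpha> k (T_op (\<alpha> + 2 * real k + 2) f) = R_op \<alpha> (Suc k) f"
    by (rule R_op_Suc_right[symmetric])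
  also have "R_op \<alpha> k (\<lambda>y. norm y powr (-1) * f y) x = norm x powr (-1) * R_op (\<alpha> + 2) k f x"
    using R_op_norm_powr_mult[OF Cm_punct_le[OF f] x, where a=\<alpha> and b="-1"] by simp
  finally show ?thesis .
qed

section \<open>Integration over \<open>\<real>\<^sup>n\<close>\<close>

lemma continuous_on_extend_punct:
  fixes u :: "'a::euclidean_space \<Rightarrow> real"
  assumes "continuous_on (-{0}) u" "closed S" "0 \<notin> S" "\<And>x. x \<notin> S \<Longrightarrow> u x = 0"
  shows "continuous_on UNIV u"
proof (rule continuous_at_imp_continuous_on, intro ballI)
  fix x :: 'a
  show "isCont u x"
  proof (cases "x = 0")
    case True
    have "eventually (\<lambda>y. u y = 0) (nhds x)"
      using assms(2,3,4) True
      by (intro eventually_nhds_in_open[of "-S", THEN eventually_mono]) auto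
    then show ?thesis
      by (subst isCont_cong) auto
  next
    case False
    then show ?thesis
      using assms(1) continuous_on_eq_continuous_at[OF open_Compl_singleton_0] by auto
  qed
qed

lemma integrable_lborel_compact_support:
  fixes u :: "'a::euclidean_space \<Rightarrow> real"
  assumes "continuous_on UNIV u" "compact S" "\<And>x. x \<notin> S \<Longrightarrow> u x = 0"
  shows "integrable lborel u"
proof -
  have "integrable lborel (\<lambda>x. indicator S x *\<^sub>R u x)"
    by (rule borel_integrable_compact[OF assms(2) continuous_on_subset[OF assms(1)]]) simp
  also have "(\<lambda>x. indicator S x *\<^sub>R u x) = u"
    using assms(3) by (auto simp: indicator_def fun_eq_iff)
  finally show ?thesis .
qed

lemma integrable_lborel_punct_compact_support:
  fixes u :: "'a::euclidean_space \<Rightarrow> real"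
  assumes "continuous_on (-{0}) u" "compact S" "0 \<notin> S" "\<And>x. x \<notin> S \<Longrightarrow> u x = 0"
  shows "integrable lborel u"
  using integrable_lborel_compact_support[OF continuous_on_extend_punct[OF assms(1)
        compact_imp_closed[OF assms(2)] assms(3,4)] assms(2,4)] .

lemma integral_dilation:
  fixes f :: "'a::euclidean_space \<Rightarrow> real"
  assumes [measurable]: "f \<in> borel_measurable borel" and t: "t > 0"
  shows "(LINT x|lborel. f (t *\<^sub>R x)) = (LINT x|lborel. f x) / t ^ DIM('a)"
proof -
  have "(LINT x|lborel. f x) =
      integral\<^sup>L (density (distr lborel borel (\<lambda>x. 0 + t *\<^sub>R x)) (\<lambda>_. \<bar>t\<bar> ^ DIM('a))) f"
    using t by (intro arg_cong[where f="\<lambda>M. integral\<^sup>L M f"] lborel_affine) simp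
  also have "\<dots> = (LINT x|lborel. \<bar>t\<bar> ^ DIM('a) *\<^sub>R f (0 + t *\<^sub>R x))"
    by (subst integral_density) (auto simp: integral_distr)
  finally show ?thesis
    using t by (simp add: field_simps)
qed

lemma integrable_dilation_compact_support:
  fixes \<phi> :: "'a::euclidean_space \<Rightarrow> real"
  assumes "continuous_on UNIV \<phi>" "compact S" "\<And>x. x \<notin> S \<Longrightarrow> \<phi> x = 0" "t > 0"
  shows "integrable lborel (\<lambda>x. \<phi> (t *\<^sub>R x))"
proof (rule integrable_lborel_compact_support)
  show "continuous_on UNIV (\<lambda>x. \<phi> (t *\<^sub>R x))"
    by (rule continuous_on_compose2[OF assms(1)]) (auto intro!: continuous_intros)
  show "compact ((*\<^sub>R) (inverse t) ` S)"
    using assms(2) by (rule compact_scaling)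
  show "\<phi> (t *\<^sub>R x) = 0" if "x \<notin> (*\<^sub>R) (inverse t) ` S" for x
  proof -
    have "inverse t *\<^sub>R (t *\<^sub>R x) = x"
      using assms(4) by simp
    then have "t *\<^sub>R x \<notin> S"
      using that by (metis image_eqI)
    then show ?thesis
      by (rule assms(3))
  qed
qed

lemma has_field_derivative_along_ray:
  fixes \<phi> :: "'a::real_normed_vector \<Rightarrow> real"
  assumes der: "(\<phi> has_derivative D) (at (z *\<^sub>R x))"
  shows "((\<lambda>s. \<phi> (s *\<^sub>R x)) has_field_derivative D x) (at z)"
proof -
  have "((\<lambda>s. \<phi> (s *\<^sub>R x)) has_derivative (\<lambda>s. D (s *\<^sub>R x))) (at z)"
    using has_derivative_compose[OF has_derivative_scaleR_left[OF has_derivative_ident, of x] der]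
    by simp
  moreover have "(\<lambda>s. D (s *\<^sub>R x)) = (*) (D x)"
    using linear_scale[OF has_derivative_linear[OF der]] by (auto simp: mult.commute)
  ultimately show ?thesis
    unfolding has_field_derivative_def by simp
qed

lemma dilation_difference_bound:
  fixes \<phi> :: "'a::euclidean_space \<Rightarrow> real"
  assumes der: "\<And>y. y \<noteq> 0 \<Longrightarrow> (\<phi> has_derivative \<phi>' y) (at y)"
    and bound: "\<And>y. \<bar>\<phi>' y y\<bar> \<le> M" and t: "1 \<le> t"
  shows "\<bar>\<phi> (t *\<^sub>R x) - \<phi> x\<bar> \<le> (t - 1) * M"
proof -
  have M: "M \<ge> 0"
    using bound[of 0] by linarith
  consider "x = 0" | "t = 1" | "x \<noteq> 0" "1 < t"
    using t by linarith
  then show ?thesis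
  proof cases
    case 3
    have "((\<lambda>s. \<phi> (s *\<^sub>R x)) has_field_derivative \<phi>' (z *\<^sub>R x) x) (at z)" if "1 \<le> z" for z
      using has_field_derivative_along_ray[OF der] 3 that by simp
    then obtain z where z: "1 < z" "z < t" "\<phi> (t *\<^sub>R x) - \<phi> (1 *\<^sub>R x) = (t - 1) * \<phi>' (z *\<^sub>R x) x"
      using MVT2[OF 3(2)] by fastforce
    have "\<phi>' (z *\<^sub>R x) (z *\<^sub>R x) = z * \<phi>' (z *\<^sub>R x) x"
      using linear_scale[OF has_derivative_linear[OF der]] 3 z by simp
    then have "z * \<bar>\<phi>' (z *\<^sub>R x) x\<bar> \<le> M"
      using bound[of "z *\<^sub>R x"] z(1) by (simp add: abs_mult)
    then have "\<bar>\<phi>' (z *\<^sub>R x) x\<bar> \<le> M"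
      using z(1) mult_right_mono[of 1 z "\<bar>\<phi>' (z *\<^sub>R x) x\<bar>"] by simp
    then show ?thesis
      using z t by (simp add: abs_mult mult_left_mono)
  qed (use M t in auto)
qed

text \<open>
  Both sides are the derivative at \<open>t = 1\<close> of \<open>t \<mapsto> \<integral> \<phi>(t x) dx\<close>: on the left computed
  under the integral sign (dominated convergence along \<open>t = 1 + h\<^sub>j\<close>), on the right from
  \<open>\<integral> \<phi>(t x) dx = t\<^sup>-\<^sup>n \<integral> \<phi>\<close>.
\<close>

lemma integral_derivative_apply_self:
  fixes \<phi> :: "'a::euclidean_space \<Rightarrow> real" and \<phi>' :: "'a \<Rightarrow> 'a \<Rightarrow> real"
  assumes S: "compact S" "0 \<notin> S" and supp: "\<And>x. x \<notin> S \<Longrightarrow> \<phi> x = 0"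
    and der: "\<And>x. x \<noteq> 0 \<Longrightarrow> (\<phi> has_derivative \<phi>' x) (at x)"
    and cont: "continuous_on (-{0}) (\<lambda>x. \<phi>' x x)"
    and supp': "\<And>x. x \<notin> S \<Longrightarrow> \<phi>' x x = 0"
  shows "(LINT x|lborel. \<phi>' x x) = - real DIM('a) * (LINT x|lborel. \<phi> x)"
proof -
  define n where "n = DIM('a)"
  define I where "I = (LINT x|lborel. \<phi> x)"
  define h :: "nat \<Rightarrow> real" where "h j = inverse (real (Suc (Suc j)))" for j
  define s where "s j x = (\<phi> ((1 + h j) *\<^sub>R x) - \<phi> x) / h j" for j x
  have h: "h j > 0" "h j < 1" for j
    unfolding h_def by (auto simp: field_simps)
  have h_at_0: "filterlim h (at 0) sequentially"
  proof (rule filterlim_atI)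
    show "h \<longlonglongrightarrow> 0"
      unfolding h_def by (rule LIMSEQ_Suc[OF LIMSEQ_inverse_real_of_nat])
    show "\<forall>\<^sub>F j in sequentially. h j \<noteq> 0"
      using h(1) by (simp add: order_less_imp_not_eq2)
  qed
  have "continuous_on (-{0}) \<phi>"
    using der by (intro continuous_at_imp_continuous_on ballI has_derivative_continuous) auto
  then have cphi: "continuous_on UNIV \<phi>"
    by (rule continuous_on_extend_punct[OF _ compact_imp_closed[OF S(1)] S(2) supp])
  then have [measurable]: "\<phi> \<in> borel_measurable borel"
    by (rule borel_measurable_continuous_onI)
  have cpsi: "continuous_on UNIV (\<lambda>x. \<phi>' x x)"
    by (rule continuous_on_extend_punct[OF cont compact_imp_closed[OF S(1)] S(2) supp'])
  then have [measurable]: "(\<lambda>x. \<phi>' x x) \<in> borel_measurable borel"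
    by (rule borel_measurable_continuous_onI)
  obtain R where R: "\<And>x. x \<in> S \<Longrightarrow> norm x \<le> R"
    using compact_imp_bounded[OF S(1)] unfolding bounded_iff by auto
  obtain M where M: "M > 0" "\<And>y. y \<in> (\<lambda>x. \<phi>' x x) ` S \<Longrightarrow> norm y \<le> M"
    using compact_imp_bounded[OF compact_continuous_image[OF continuous_on_subset[OF cpsi] S(1)]]
    unfolding bounded_pos by auto
  have bound: "\<bar>\<phi>' x x\<bar> \<le> M" for x
    using M supp'[of x] by (cases "x \<in> S") auto

  have integral_s: "(LINT x|lborel. s j x) = (inverse ((1 + h j) ^ n) - 1) / h j * I" for j
  proof -
    have "integrable lborel (\<lambda>x. \<phi> ((1 + h j) *\<^sub>R x))" "integrable lborel \<phi>"
      using integrable_dilation_compact_support[OF cphi S(1) supp] h(1)[of j]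
        integrable_lborel_compact_support[OF cphi S(1) supp] by simp_all
    then show ?thesis
      unfolding s_def I_def n_def using integral_dilation[of \<phi> "1 + h j"] h(1)[of j]
      by (simp add: field_simps)
  qed
  have quotient: "((\<lambda>t. (inverse ((1 + t) ^ n) - 1) / t) \<longlongrightarrow> - real n) (at 0)"
  proof -
    have "((\<lambda>t. inverse ((1 + t) ^ n)) has_field_derivative - real n) (at 0)"
      by (auto intro!: derivative_eq_intros)
    then show ?thesis
      unfolding DERIV_def by simp
  qed
  have "(\<lambda>j. LINT x|lborel. s j x) \<longlonglongrightarrow> - real n * I"
    unfolding integral_s by (rule tendsto_mult_right[OF filterlim_compose[OF quotient h_at_0]])

  moreover have "(\<lambda>j. LINT x|lborel. s j x) \<longlonglongrightarrow> (LINT x|lborel. \<phi>' x x)"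
  proof (rule integral_dominated_convergence[where w="\<lambda>x. indicator (cball 0 R) x *\<^sub>R M"])
    show "integrable lborel (\<lambda>x. indicator (cball 0 R) x *\<^sub>R M)"
      by (rule borel_integrable_compact) auto
    show "AE x in lborel. (\<lambda>j. s j x) \<longlonglongrightarrow> \<phi>' x x"
    proof (rule AE_I2)
      fix x :: 'a
      show "(\<lambda>j. s j x) \<longlonglongrightarrow> \<phi>' x x"
      proof (cases "x = 0")
        case True
        then show ?thesis
          unfolding s_def using supp'[of 0] S(2) by simp
      next
        case False
        then have "((\<lambda>t. (\<phi> ((1 + t) *\<^sub>R x) - \<phi> x) / t) \<longlongrightarrow> \<phi>' x x) (at 0)"
          using has_field_derivative_along_ray[OF der, of 1 x] unfolding DERIV_def by simp
        then show ?thesis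
          unfolding s_def by (rule filterlim_compose[OF _ h_at_0])
      qed
    qed
    show "AE x in lborel. norm (s j x) \<le> indicator (cball 0 R) x *\<^sub>R M" for j
    proof (rule AE_I2)
      fix x :: 'a
      show "norm (s j x) \<le> indicator (cball 0 R) x *\<^sub>R M"
      proof (cases "norm x \<le> R")
        case True
        then show ?thesis
          using dilation_difference_bound[OF der bound, of "1 + h j" x] h[of j]
          by (simp add: s_def divide_le_eq mult.commute)
      next
        case False
        have "norm x \<le> norm ((1 + h j) *\<^sub>R x)"
          using h(1)[of j] by (simp add: mult_le_cancel_right1)
        then have "x \<notin> S" "(1 + h j) *\<^sub>R x \<notin> S"
          using R False by force+
        then show ?thesis
          using False by (simp add: s_def supp)
      qed
    qed
  qed (auto simp: s_def)
  ultimately show ?thesis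
    unfolding n_def I_def by (rule LIMSEQ_unique[rotated])
qed

section \<open>Weighted identities\<close>

lemma winner_rad_deriv_self:
  fixes g :: "'a::euclidean_space \<Rightarrow> real"
  assumes g: "Cm_punct 1 g" and S: "compact S" "0 \<notin> S" and supp: "\<And>x. x \<notin> S \<Longrightarrow> g x = 0"
  shows "winner (\<alpha> + 1) g (rad_deriv g) = - ((real DIM('a) - 2 - \<alpha>) / 2) * wnorm2 (\<alpha> + 2) g"
proof -
  define p where "p = -(\<alpha> + 2)"
  have dg: "g differentiable (at x)" if "x \<noteq> 0" for x
    using g that by simp
  have cg: "continuous_on (-{0}) g" and cdg: "continuous_on (-{0}) (rad_deriv g)"
    using Cm_punct_Suc_imp[of 0 g] Cm_punct_rad_deriv[of 0 g] g by simp_all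
  define \<phi>' where "\<phi>' x v = g x * g x * (p * norm x powr (p - 2) * (x \<bullet> v))
      + (g x * frechet_derivative g (at x) v + frechet_derivative g (at x) v * g x) * norm x powr p"
    for x v
  have der: "((\<lambda>x. g x * g x * norm x powr p) has_derivative \<phi>' x) (at x)" if "x \<noteq> 0" for x
    unfolding \<phi>'_def
    by (rule has_derivative_mult[OF has_derivative_mult has_derivative_norm_powr[OF that]])
      (use dg[OF that] in \<open>simp_all add: frechet_derivative_works[symmetric]\<close>)
  have \<phi>'_self: "\<phi>' x x = p * ((g x)\<^sup>2 * norm x powr p)
      + 2 * (g x * rad_deriv g x * norm x powr (-(\<alpha> + 1)))" for x
  proof (cases "x = 0")
    case False
    then have nx: "norm x > 0"
      by simp
    have "(x \<bullet> x) * norm x powr (p - 2) = norm x powr p"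
      using nx by (simp add: powr_diff dot_square_norm power2_eq_square)
    moreover have "norm x * norm x powr p = norm x powr (-(\<alpha> + 1))"
      using nx powr_add[of "norm x" 1 p] by (simp add: p_def add.commute)
    ultimately show ?thesis
      unfolding \<phi>'_def frechet_derivative_apply_self[OF dg[OF False]]
      by (simp add: algebra_simps power2_eq_square)
  qed (simp add: \<phi>'_def)
  have "integrable lborel (\<lambda>x. (g x)\<^sup>2 * norm x powr p)"
    and "integrable lborel (\<lambda>x. g x * rad_deriv g x * norm x powr (-(\<alpha> + 1)))"
    by (auto intro!: integrable_lborel_punct_compact_support[OF _ S] continuous_intros cg cdg
        continuous_on_norm_powr_punct simp: supp)
  then have "(LINT x|lborel. \<phi>' x x) = p * (LINT x|lborel. (g x)\<^sup>2 * norm x powr p)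
      + 2 * (LINT x|lborel. g x * rad_deriv g x * norm x powr (-(\<alpha> + 1)))"
    unfolding \<phi>'_self by simp
  moreover have "(LINT x|lborel. \<phi>' x x) = - real DIM('a) * (LINT x|lborel. g x * g x * norm x powr p)"
    by (rule integral_derivative_apply_self[OF S _ der])
      (auto intro!: continuous_intros cg cdg continuous_on_norm_powr_punct simp: \<phi>'_self supp)
  ultimately show ?thesis
    unfolding winner_def wnorm2_def p_def by (simp add: power2_eq_square field_simps)
qed

text \<open>\<open>T\<^sub>\<alpha>\<close> is the skew-adjoint part of \<open>\<partial>\<^sub>r\<close> in \<open>L\<^sup>2(|x|\<^sup>-\<^sup>\<alpha>\<^sup>-\<^sup>1 dx)\<close>.\<close>

lemma winner_T_op_self:
  fixes g :: "'a::euclidean_space \<Rightarrow> real"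
  assumes g: "Cm_punct 1 g" and S: "compact S" "0 \<notin> S" and supp: "\<And>x. x \<notin> S \<Longrightarrow> g x = 0"
  shows "winner (\<alpha> + 1) (T_op \<alpha> g) g = 0"
proof -
  have cg: "continuous_on (-{0}) g" and cdg: "continuous_on (-{0}) (rad_deriv g)"
    using Cm_punct_Suc_imp[of 0 g] Cm_punct_rad_deriv[of 0 g] g by simp_all
  have "T_op \<alpha> g x * g x * norm x powr (-(\<alpha> + 1)) = g x * rad_deriv g x * norm x powr (-(\<alpha> + 1))
      + (real DIM('a) - 2 - \<alpha>) / 2 * ((g x)\<^sup>2 * norm x powr (-(\<alpha> + 2)))" for x
  proof -
    have "-(\<alpha> + 2) = -1 + -(\<alpha> + 1)"
      by simp
    then have "norm x powr (-(\<alpha> + 2)) = norm x powr (-1) * norm x powr (-(\<alpha> + 1))"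
      by (simp only: powr_add)
    then show ?thesis
      unfolding T_op_eq_rad_deriv_plus power2_eq_square by algebra
  qed
  moreover have "integrable lborel (\<lambda>x. (g x)\<^sup>2 * norm x powr (-(\<alpha> + 2)))"
    and "integrable lborel (\<lambda>x. g x * rad_deriv g x * norm x powr (-(\<alpha> + 1)))"
    by (auto intro!: integrable_lborel_punct_compact_support[OF _ S] continuous_intros cg cdg
        continuous_on_norm_powr_punct simp: supp)
  ultimately show ?thesis
    using winner_rad_deriv_self[OF assms, of \<alpha>] unfolding winner_def wnorm2_def by simp
qed

lemma wnorm2_winner_T_op_minus:
  fixes g u :: "'a::euclidean_space \<Rightarrow> real"
  assumes g: "Cm_punct 1 g" and S: "compact S" "0 \<notin> S" and supp: "\<And>x. x \<notin> S \<Longrightarrow> g x = 0"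
    and u: "\<And>x. x \<noteq> 0 \<Longrightarrow> u x = T_op \<alpha> g x - c * (norm x powr (-1) * g x)"
  shows "wnorm2 \<alpha> u = c\<^sup>2 * wnorm2 (\<alpha> + 2) g + wnorm2 \<alpha> (T_op \<alpha> g)"
    and "winner (\<alpha> + 1) u g = - c * wnorm2 (\<alpha> + 2) g"
proof -
  define h where "h = T_op \<alpha> g"
  have cg: "continuous_on (-{0}) g" and ch: "continuous_on (-{0}) h"
    using Cm_punct_Suc_imp[of 0 g] Cm_punct_T_op[of 0 g \<alpha>] g by (simp_all add: h_def)
  have supp_h: "h x = 0" if "x \<notin> S" for x
    using R_op_eq_0_open[of "-S" g x \<alpha> 0] compact_imp_closed[OF S(1)] supp that
    by (simp add: h_def open_Compl)
  have "-(\<alpha> + 1) = -1 + -\<alpha>" "-(\<alpha> + 2) = -1 + -(\<alpha> + 1)"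
    by simp_all
  then have weight: "norm x powr (-(\<alpha> + 1)) = norm x powr (-1) * norm x powr (-\<alpha>)"
      "norm x powr (-(\<alpha> + 2)) = norm x powr (-1) * norm x powr (-(\<alpha> + 1))" for x :: 'a
    by (simp_all only: powr_add)
  have square: "(u x)\<^sup>2 * norm x powr (-\<alpha>) = (h x)\<^sup>2 * norm x powr (-\<alpha>)
      - 2 * c * (h x * g x * norm x powr (-(\<alpha> + 1))) + c\<^sup>2 * ((g x)\<^sup>2 * norm x powr (-(\<alpha> + 2)))"
    for x
  proof (cases "x = 0")
    case False
    show ?thesis
      unfolding u[OF False] h_def weight power2_eq_square by algebra
  qed simp
  have product: "u x * g x * norm x powr (-(\<alpha> + 1)) = h x * g x * norm x powr (-(\<alpha> + 1))
      - c * ((g x)\<^sup>2 * norm x powr (-(\<alpha> + 2)))" for x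
  proof (cases "x = 0")
    case False
    show ?thesis
      unfolding u[OF False] h_def weight power2_eq_square by algebra
  qed simp
  have "integrable lborel (\<lambda>x. (h x)\<^sup>2 * norm x powr (-\<alpha>))"
    and "integrable lborel (\<lambda>x. h x * g x * norm x powr (-(\<alpha> + 1)))"
    and "integrable lborel (\<lambda>x. (g x)\<^sup>2 * norm x powr (-(\<alpha> + 2)))"
    by (auto intro!: integrable_lborel_punct_compact_support[OF _ S] continuous_intros cg ch
        continuous_on_norm_powr_punct simp: supp supp_h)
  moreover have "(LINT x|lborel. h x * g x * norm x powr (-(\<alpha> + 1))) = 0"
    using winner_T_op_self[OF assms(1-4), of \<alpha>] unfolding winner_def h_def .
  ultimately show "wnorm2 \<alpha> u = c\<^sup>2 * wnorm2 (\<alpha> + 2) g + wnorm2 \<alpha> (T_op \<alpha> g)"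
    and "winner (\<alpha> + 1) u g = - c * wnorm2 (\<alpha> + 2) g"
    unfolding wnorm2_def winner_def square product h_def[symmetric] by simp_all
qed

theorem lemma2p3:
  fixes \<alpha> \<beta> :: real and k :: nat
  shows "(\<forall>f :: 'a::euclidean_space \<Rightarrow> real. Cc_punct (k + 1) f \<longrightarrow>
            (\<forall>x. x \<noteq> 0 \<longrightarrow>
               R_op \<alpha> k (\<lambda>y. norm y powr \<beta> * f y) x = norm x powr \<beta> * R_op (\<alpha> - 2 * \<beta>) k f x))
       \<and> (\<forall>f :: 'a \<Rightarrow> real. Cc_punct (k + 2) f \<longrightarrow>
            wnorm2 \<alpha> (R_op \<alpha> k (rad_deriv f)) =
              (real DIM('a) - 2 * real k - 4 - \<alpha>)\<^sup>2 / 4 * wnorm2 (\<alpha> + 2) (R_op (\<alpha> + 2) k f)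
              + wnorm2 \<alpha> (R_op \<alpha> (k + 1) f)
            \<and> winner (\<alpha> + 1) (R_op \<alpha> k (rad_deriv f)) (R_op (\<alpha> + 2) k f) =
              (\<alpha> + 2 * real k + 4 - real DIM('a)) / 2 * wnorm2 (\<alpha> + 2) (R_op (\<alpha> + 2) k f))"
proof (intro conjI allI impI)
  fix f :: "'a \<Rightarrow> real" and x :: 'a
  assume "Cc_punct (k + 1) f" "x \<noteq> 0"
  then show "R_op \<alpha> k (\<lambda>y. norm y powr \<beta> * f y) x = norm x powr \<beta> * R_op (\<alpha> - 2 * \<beta>) k f x"
    unfolding Cc_punct_def by (blast intro: R_op_norm_powr_mult Cm_imp_Cm_punct)
next
  fix f :: "'a \<Rightarrow> real"
  assume "Cc_punct (k + 2) f"
  then have f: "Cm_punct (k + 2) f" and S: "compact (closure {x. f x \<noteq> 0})"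
      "0 \<notin> closure {x. f x \<noteq> 0}"
    unfolding Cc_punct_def by (auto intro: Cm_imp_Cm_punct)
  define g where "g = R_op (\<alpha> + 2) k f"
  define c where "c = (real DIM('a) - \<alpha> - 2 * real k - 4) / 2"
  have g: "Cm_punct 1 g"
    unfolding g_def using Cm_punct_R_op[of k 1 f] f by (simp add: add.commute)
  have supp: "g x = 0" if "x \<notin> closure {x. f x \<noteq> 0}" for x
    unfolding g_def by (rule R_op_eq_0_open[of "- closure {x. f x \<noteq> 0}"])
      (use that closure_subset[of "{x. f x \<noteq> 0}"] in auto)
  have "R_op \<alpha> k (rad_deriv f) x = T_op \<alpha> g x - c * (norm x powr (-1) * g x)" if "x \<noteq> 0" for x
    using R_op_rad_deriv[OF f that] unfolding g_def c_def by simp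
  note identities = wnorm2_winner_T_op_minus[OF g S supp this]
  have "(real DIM('a) - 2 * real k - 4 - \<alpha>)\<^sup>2 / 4 = c\<^sup>2"
    unfolding c_def by (simp add: power2_eq_square field_simps)
  then show "wnorm2 \<alpha> (R_op \<alpha> k (rad_deriv f)) =
      (real DIM('a) - 2 * real k - 4 - \<alpha>)\<^sup>2 / 4 * wnorm2 (\<alpha> + 2) (R_op (\<alpha> + 2) k f)
      + wnorm2 \<alpha> (R_op \<alpha> (k + 1) f)"
    using identities(1) by (simp add: g_def)
  have "(\<alpha> + 2 * real k + 4 - real DIM('a)) / 2 = - c"
    unfolding c_def by (simp add: field_simps)
  then show "winner (\<alpha> + 1) (R_op \<alpha> k (rad_deriv f)) (R_op (\<alpha> + 2) k f) =
      (\<alpha> + 2 * real k + 4 - real DIM('a)) / 2 * wnorm2 (\<alpha> + 2) (R_op (\<alpha> + 2) k f)"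
    using identities(2) by (simp add: g_def)
qed

end
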